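(* For $C>0$ sufficiently large (i.e. there exists $C_1<\infty$ such that for all $C\ge C_1$), $$\mathbb{P}\left(\exists\, \tau\in[0,1] \text{ such that } \limsup_{t\to\infty}\frac{S_0^{\tau}(t)}{\sqrt{t\log(t)}}\ge C\right)=0 .$$
   Context: Dynamical discrete web (DyDW): let $\mathbb{Z}^2_{\mathrm{even}}=\{(x,t)\in\mathbb{Z}^2: x+t \text{ even}\}$, where $x$ is space and $t$ is (random walk) time. To each $z\in\mathbb{Z}^2_{\mathrm{even}}$ assign, independently over $z$, a right-continuous process $(\xi_z^\tau)_{\tau\ge 0}$ with values in $\{-1,+1\}$: $\xi_z^0$ is uniform on $\{\pm1\}$, and at each ring of a rate one Poisson clock attached to $z$ the value is replaced by a fresh independent uniform $\pm1$ variable (which may agree with the old value). All clocks, initial values and resampled values are independent. The parameter $\tau$ is called dynamical time. For fixed $\tau$, draw an arrow from each $(x,t)\in\mathbb{Z}^2_{\mathrm{even}}$ to $(x+\xi_{(x,t)}^\tau,t+1)$; $S_{z}^{\tau}(\cdot)$ denotes the path that starts at $z$ and follows the arrows at dynamical time $\tau$ (linearly interpolated between integer times). $S_0^\tau:=S_{(0,0)}^\tau$ is the path from the origin. *)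

theory Defs
  imports "HOL-Probability.Probability"
begin

text \<open>Sites are pairs (space, time).\<close>

definition even_lattice :: "(int \<times> int) set" where
  "even_lattice = {(x, t). even (x + t)}"

text \<open>
  The rate one Poisson clock at a site is given by its inter-ring times, which are independent
  and exponentially distributed with parameter 1. The variable \<open>spin z 0\<close> is the initial value at
  the site \<open>z\<close>, and \<open>spin z (Suc n)\<close> is the fresh value drawn at the ring with (zero-based) number
  \<open>n\<close>. The spins are embedded into the reals in the independence assumption only because
  \<open>indep_vars\<close> needs a common codomain; the embedding is injective, so the generated
  sigma-algebras are unchanged. Nothing is assumed about sites outside the even lattice.
\<close>

locale dynamical_discrete_web = prob_space M
  for M :: "'w measure" +
  fixes spin :: "int \<times> int \<Rightarrow> nat \<Rightarrow> 'w \<Rightarrow> int"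
    and gap :: "int \<times> int \<Rightarrow> nat \<Rightarrow> 'w \<Rightarrow> real"
  assumes spin_uniform:
      "\<And>z n. z \<in> even_lattice \<Longrightarrow>
         distr M (count_space UNIV) (spin z n) = measure_pmf (pmf_of_set {-1, 1})"
    and gap_exponential:
      "\<And>z n. z \<in> even_lattice \<Longrightarrow> distributed M lborel (gap z n) (exponential_density 1)"
    and all_independent:
      "indep_vars (\<lambda>_. borel)
         (case_sum (\<lambda>(z, n) \<omega>. real_of_int (spin z n \<omega>)) (\<lambda>(z, n) \<omega>. gap z n \<omega>))
         ((even_lattice \<times> UNIV) <+> (even_lattice \<times> UNIV))"

definition ring_time :: "(int \<times> int \<Rightarrow> nat \<Rightarrow> 'w \<Rightarrow> real) \<Rightarrow> int \<times> int \<Rightarrow> nat \<Rightarrow> 'w \<Rightarrow> real" where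
  "ring_time gap z n \<omega> = (\<Sum>k\<le>n. gap z k \<omega>)"

text \<open>
  Almost surely only finitely many rings occur up to time \<open>\<tau>\<close>, so that the convention
  \<open>card A = 0\<close> for infinite \<open>A\<close> matters only on a null set.
\<close>

definition ring_count :: "(int \<times> int \<Rightarrow> nat \<Rightarrow> 'w \<Rightarrow> real) \<Rightarrow> int \<times> int \<Rightarrow> real \<Rightarrow> 'w \<Rightarrow> nat" where
  "ring_count gap z \<tau> \<omega> = card {n. ring_time gap z n \<omega> \<le> \<tau>}"

text \<open>The value of the process at site \<open>z\<close> and dynamical time \<open>\<tau>\<close>.\<close>

definition \<xi> ::
    "(int \<times> int \<Rightarrow> nat \<Rightarrow> 'w \<Rightarrow> int) \<Rightarrow> (int \<times> int \<Rightarrow> nat \<Rightarrow> 'w \<Rightarrow> real) \<Rightarrow>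
     int \<times> int \<Rightarrow> real \<Rightarrow> 'w \<Rightarrow> int" where
  "\<xi> spin gap z \<tau> \<omega> = spin z (ring_count gap z \<tau> \<omega>) \<omega>"

text \<open>
  For an arrow configuration \<open>e\<close>, the spatial position of the path started at \<open>z\<close> after \<open>k\<close> steps,
  that is, at time \<open>snd z + k\<close>.
\<close>

primrec arrow_pos :: "(int \<times> int \<Rightarrow> int) \<Rightarrow> int \<times> int \<Rightarrow> nat \<Rightarrow> int" where
  "arrow_pos e z 0 = fst z"
| "arrow_pos e z (Suc k) = arrow_pos e z k + e (arrow_pos e z k, snd z + int k)"

text \<open>Linear interpolation; meaningful for times \<open>t \<ge> snd z\<close>.\<close>

definition arrow_path :: "(int \<times> int \<Rightarrow> int) \<Rightarrow> int \<times> int \<Rightarrow> real \<Rightarrow> real" where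
  "arrow_path e z t =
     (let s = t - real_of_int (snd z); k = nat \<lfloor>s\<rfloor> in
      (1 - frac s) * real_of_int (arrow_pos e z k) + frac s * real_of_int (arrow_pos e z (Suc k)))"

definition dyn_path ::
    "(int \<times> int \<Rightarrow> nat \<Rightarrow> 'w \<Rightarrow> int) \<Rightarrow> (int \<times> int \<Rightarrow> nat \<Rightarrow> 'w \<Rightarrow> real) \<Rightarrow>
     int \<times> int \<Rightarrow> real \<Rightarrow> 'w \<Rightarrow> real \<Rightarrow> real" where
  "dyn_path spin gap z \<tau> \<omega> t = arrow_path (\<lambda>z'. \<xi> spin gap z' \<tau> \<omega>) z t"

end

theory Submission
  imports Defs "HOL-Real_Asymp.Real_Asymp"
begin

text \<open>
  Condition on all clocks. For a dynamical time that depends on the clocks only, the path is then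
  a simple random walk, so that by Chernoff's bound it exceeds \<open>4 sqrt (n ln n)\<close> at time \<open>n\<close> with
  probability at most \<open>n\<^sup>-\<^sup>4\<close>. Up to time \<open>n\<close> the path sees only the \<open>O(n\<^sup>2)\<close> sites of the light
  cone, and its dynamics on \<open>[0, 1]\<close> changes only at ring times of these sites, of which there are
  \<open>O(n\<^sup>2)\<close> in expectation. A union bound over time \<open>0\<close> and these ring times gives a summable
  bound \<open>O(n\<^sup>-\<^sup>2)\<close> for the event that the level is exceeded at some dynamical time in \<open>[0, 1]\<close>.
\<close>

section \<open>Arrow paths in the light cone, and an elementary bound on cosh\<close>

lemma arrow_pos_parity:
  assumes "\<And>z. odd (e z)"
  shows "even (arrow_pos e (0, 0) k + int k)"
proof (induction k)
  case (Suc k)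
  with assms[of "(arrow_pos e (0, 0) k, int k)"] show ?case by auto
qed simp

text \<open>Steps of size one and the parity invariant keep the path of \<open>e'\<close> in the
  light cone, so by induction both paths only read arrows on which the two configurations agree. The
  values of \<open>e\<close> outside the cone stay uncontrolled, which suits the raw arrows of the
  web.\<close>

lemma arrow_pos_cong:
  assumes "\<And>x t. \<bar>x\<bar> \<le> t \<Longrightarrow> t < int n \<Longrightarrow> even (x + t) \<Longrightarrow> e (x, t) = e' (x, t)"
    and e': "\<And>z. e' z \<in> {-1, 1}" and "k \<le> n"
  shows "arrow_pos e (0, 0) k = arrow_pos e' (0, 0) k \<and> \<bar>arrow_pos e' (0, 0) k\<bar> \<le> int k"
  using \<open>k \<le> n\<close>
proof (induction k)
  case (Suc k)
  have "odd (e' z)" for z using e'[of z] by auto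
  then have "even (arrow_pos e' (0, 0) k + int k)" by (rule arrow_pos_parity)
  then have "e (arrow_pos e' (0, 0) k, int k) = e' (arrow_pos e' (0, 0) k, int k)"
    using Suc by (intro assms(1)) auto
  with Suc show ?case using e'[of "(arrow_pos e' (0, 0) k, int k)"] by auto
qed simp

text \<open>On the unit interval exp l is at most 1 + l + l^2, and exp (-l) is at most 1 - l + l^2.
  The linear terms cancel in the average.\<close>

lemma cosh_le_exp_square:
  fixes l :: real
  assumes "0 \<le> l" "l \<le> 1"
  shows "cosh l \<le> exp (l\<^sup>2)"
proof -
  have "exp (- l) = 1 / exp l" by (simp add: exp_minus divide_inverse)
  also have "\<dots> \<le> 1 / (1 + l)" using assms by (intro divide_left_mono) auto
  also have "\<dots> \<le> 1 - l + l\<^sup>2" using assms by (simp add: field_simps power2_eq_square)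
  finally have "cosh l \<le> 1 + l\<^sup>2" using exp_bound[OF assms] by (simp add: cosh_def)
  then show ?thesis using exp_ge_add_one_self[of "l\<^sup>2"] by linarith
qed

context dynamical_discrete_web
begin

section \<open>Sigma-algebras generated by the clocks and the lower rows of spins\<close>

abbreviation coord :: "((int \<times> int) \<times> nat) + ((int \<times> int) \<times> nat) \<Rightarrow> 'w \<Rightarrow> real" where
  "coord \<equiv> case_sum (\<lambda>(z, n) \<omega>. real_of_int (spin z n \<omega>)) (\<lambda>(z, n) \<omega>. gap z n \<omega>)"

text \<open>Rows strictly below \<open>k\<close> determine the first \<open>k\<close> steps from the
  origin, while row \<open>k\<close>, which supplies the next step, stays fresh. For
  \<open>k = 0\<close> the only spins included lie at negative times, where the path from the origin
  never goes, so \<open>past 0\<close> stands for the information in the clocks.\<close>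

definition known :: "nat \<Rightarrow> (((int \<times> int) \<times> nat) + ((int \<times> int) \<times> nat)) set" where
  "known k = ({z \<in> even_lattice. snd z < int k} \<times> UNIV) <+> (even_lattice \<times> UNIV)"

lemma Inl_in_known [simp]: "Inl (z, n) \<in> known k \<longleftrightarrow> z \<in> even_lattice \<and> snd z < int k"
  and Inr_in_known [simp]: "Inr (z, n) \<in> known k \<longleftrightarrow> z \<in> even_lattice"
  unfolding known_def by auto

text \<open>All clocks are revealed at the outset; only the spins are revealed row by row.\<close>

definition past :: "nat \<Rightarrow> 'w measure" where
  "past k = sigma (space M) (\<Union>i\<in>known k. {coord i -` A \<inter> space M | A. A \<in> sets borel})"

lemma space_past [simp]: "space (past k) = space M"
  unfolding past_def by (rule space_measure_of) auto

lemma sets_past: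
  "sets (past k) = sigma_sets (space M) (\<Union>i\<in>known k. {coord i -` A \<inter> space M | A. A \<in> sets borel})"
  unfolding past_def by (rule sets_measure_of) auto

lemma known_mono: "j \<le> k \<Longrightarrow> known j \<subseteq> known k"
  unfolding known_def by force

lemma sets_past_mono: "j \<le> k \<Longrightarrow> sets (past j) \<subseteq> sets (past k)"
  unfolding sets_past using known_mono[of j k] by (intro sigma_sets_mono') blast

lemma measurable_past_mono: "j \<le> k \<Longrightarrow> f \<in> past j \<rightarrow>\<^sub>M N \<Longrightarrow> f \<in> past k \<rightarrow>\<^sub>M N"
  using sets_past_mono[of j k] unfolding measurable_def by auto

lemma measurable_coord:
  "i \<in> (even_lattice \<times> UNIV) <+> (even_lattice \<times> UNIV) \<Longrightarrow> coord i \<in> borel_measurable M"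
  using all_independent unfolding indep_vars_def by blast

lemma sets_past_subset: "sets (past k) \<subseteq> sets M"
proof -
  have "(\<Union>i\<in>known k. {coord i -` A \<inter> space M | A. A \<in> sets borel}) \<subseteq> sets M"
  proof safe
    fix i and A :: "real set" assume "i \<in> known k" "A \<in> sets borel"
    then show "coord i -` A \<inter> space M \<in> sets M"
      using measurable_coord[of i] unfolding known_def by (intro measurable_sets) auto
  qed
  then show ?thesis unfolding sets_past by (rule sets.sigma_sets_subset)
qed

lemma measurable_past_imp: "f \<in> past k \<rightarrow>\<^sub>M N \<Longrightarrow> f \<in> M \<rightarrow>\<^sub>M N"
  using sets_past_subset[of k] unfolding measurable_def by auto

lemma coord_measurable_past:
  assumes "i \<in> known k" shows "coord i \<in> borel_measurable (past k)"
  using assms by (intro measurableI) (auto simp: sets_past intro!: sigma_sets.Basic)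

lemma gap_measurable_past [measurable]:
  "z \<in> even_lattice \<Longrightarrow> gap z n \<in> borel_measurable (past k)"
  using coord_measurable_past[of "Inr (z, n)" k] by simp

lemma spin_measurable_past:
  assumes "z \<in> even_lattice" "snd z < int k"
  shows "spin z n \<in> past k \<rightarrow>\<^sub>M count_space UNIV"
proof -
  have "(\<lambda>\<omega>. real_of_int (spin z n \<omega>)) \<in> borel_measurable (past k)"
    using assms coord_measurable_past[of "Inl (z, n)" k] by simp
  \<comment> \<open>The floor recovers the integer spin from its real embedding.\<close>
  then have "(\<lambda>\<omega>. \<lfloor>real_of_int (spin z n \<omega>)\<rfloor>) \<in> past k \<rightarrow>\<^sub>M count_space UNIV"
    by measurable
  then show ?thesis by simp
qed

lemma spin_measurable [measurable]:
  "z \<in> even_lattice \<Longrightarrow> spin z n \<in> M \<rightarrow>\<^sub>M count_space UNIV"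
  by (rule measurable_past_imp[OF spin_measurable_past[of z "nat (snd z) + 1"]]) auto

lemma gap_measurable [measurable]: "z \<in> even_lattice \<Longrightarrow> gap z n \<in> borel_measurable M"
  by (rule measurable_past_imp[OF gap_measurable_past])

text \<open>The case \<open>k = 0\<close> is what admits a ring time as the dynamical time of a walk
  below.\<close>

lemma ring_time_measurable_past [measurable]:
  "z \<in> even_lattice \<Longrightarrow> ring_time gap z n \<in> borel_measurable (past k)"
  unfolding ring_time_def by measurable

lemma ring_time_measurable [measurable]:
  "z \<in> even_lattice \<Longrightarrow> ring_time gap z n \<in> borel_measurable M"
  by (rule measurable_past_imp[OF ring_time_measurable_past])

lemma ring_count_measurable_past:
  assumes [measurable]: "z \<in> even_lattice" "\<tau> \<in> borel_measurable (past k)"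
  shows "(\<lambda>\<omega>. ring_count gap z (\<tau> \<omega>) \<omega>) \<in> past k \<rightarrow>\<^sub>M count_space UNIV"
  unfolding ring_count_def by measurable

text \<open>A spin of row \<open>k\<close> has an index outside \<open>known k\<close>. Disjoint
  blocks of independent coordinates generate independent sigma-algebras, and integrals of
  independent nonnegative functions multiply.\<close>

lemma spin_indep_past:
  assumes f: "f \<in> borel_measurable (past k)" and z: "z \<in> even_lattice" "snd z = int k"
    and g: "g \<in> borel_measurable borel"
  shows "(\<integral>\<^sup>+\<omega>. f \<omega> * g (real_of_int (spin z n \<omega>)) \<partial>M) =
    (\<integral>\<^sup>+\<omega>. f \<omega> \<partial>M) * (\<integral>\<^sup>+\<omega>. g (real_of_int (spin z n \<omega>)) \<partial>M :: ennreal)"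
proof -
  let ?E = "\<lambda>i. {coord i -` A \<inter> space M | A. A \<in> sets borel}"
  let ?I = "case_bool (known k) {Inl (z, n)}"
  let ?G = "\<lambda>\<omega>. g (real_of_int (spin z n \<omega>))"
  have sub: "(\<Union>b. ?I b) \<subseteq> (even_lattice \<times> UNIV) <+> (even_lattice \<times> UNIV)"
    using z by (auto simp: known_def split: bool.splits)
  have "indep_sets ?E ((even_lattice \<times> UNIV) <+> (even_lattice \<times> UNIV))"
    using all_independent unfolding indep_vars_def2 by simp
  then have "indep_sets ?E (\<Union>b. ?I b)"
    by (rule indep_sets_mono_index[OF sub])
  then have "indep_sets (\<lambda>b. sigma_sets (space M) (\<Union>i\<in>?I b. ?E i)) UNIV"
  proof (rule indep_sets_collect_sigma)
    show "Int_stable (?E i)" for i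
    proof (rule Int_stableI)
      fix a b assume "a \<in> ?E i" "b \<in> ?E i"
      then obtain A B where "A \<in> sets borel" "B \<in> sets borel"
        "a = coord i -` A \<inter> space M" "b = coord i -` B \<inter> space M" by blast
      then show "a \<inter> b \<in> ?E i" by (intro CollectI exI[of _ "A \<inter> B"]) auto
    qed
    show "disjoint_family_on ?I UNIV"
      using z by (auto simp: disjoint_family_on_def known_def split: bool.splits)
  qed
  then have ind: "indep_sets (case_bool (sets (past k))
      (sigma_sets (space M) (?E (Inl (z, n))))) UNIV"
    unfolding sets_past
    by (rule indep_sets_mono) (auto split: bool.splits)
  have [measurable]: "f \<in> borel_measurable M" "?G \<in> borel_measurable M"
    using measurable_past_imp[OF f] measurable_compose[OF measurable_coord[of "Inl (z, n)"] g] z by auto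
  \<comment> \<open>Each factor generates a sigma-algebra contained in that of its own block, so
    independence is inherited from \<open>ind\<close>.\<close>
  have "indep_set (sigma_sets (space M) {f -` A \<inter> space M |A. A \<in> sets borel})
     (sigma_sets (space M) {?G -` A \<inter> space M |A. A \<in> sets borel})"
    unfolding indep_set_def
  proof (rule indep_sets_mono_sets[OF ind])
    fix b :: bool
    have 1: "sigma_sets (space M) {f -` A \<inter> space M |A. A \<in> sets borel} \<subseteq> sets (past k)"
      using sets.sigma_sets_subset[of "{f -` A \<inter> space M |A. A \<in> sets borel}" "past k"]
        measurable_sets[OF f] by auto
    have 2: "sigma_sets (space M) {?G -` A \<inter> space M |A. A \<in> sets borel}
      \<subseteq> sigma_sets (space M) (?E (Inl (z, n)))"
    proof (rule sigma_sets_mono', safe)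
      fix A :: "ennreal set" assume "A \<in> sets borel"
      then have "g -` A \<in> sets borel" using measurable_sets[OF g] by auto
      then show "\<exists>B. ?G -` A \<inter> space M = coord (Inl (z, n)) -` B \<inter> space M \<and> B \<in> sets borel"
        by (intro exI[of _ "g -` A"]) auto
    qed
    from 1 2 show "case_bool (sigma_sets (space M) {f -` A \<inter> space M |A. A \<in> sets borel})
     (sigma_sets (space M) {?G -` A \<inter> space M |A. A \<in> sets borel}) b
      \<subseteq> case_bool (sets (past k)) (sigma_sets (space M) (?E (Inl (z, n)))) b"
      by (cases b) auto
  qed
  then have "indep_var borel f borel ?G" unfolding indep_var_eq by simp
  \<comment> \<open>The codomains in \<open>indep_var\<close> form a \<open>case_bool\<close>
    family; it is rewritten as a constant one to match the product formula.\<close>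
  then have "indep_vars (\<lambda>_. borel) (case_bool f ?G) UNIV"
    unfolding indep_var_def by (rule back_subst[where P = "\<lambda>x. indep_vars x _ _"]) (auto split: bool.splits)
  from indep_vars_nn_integral[OF _ this] show ?thesis
    by (simp add: UNIV_bool mult.commute)
qed

section \<open>The law of a single spin\<close>

lemma AE_spin: "z \<in> even_lattice \<Longrightarrow> AE \<omega> in M. spin z n \<omega> \<in> {-1, 1}"
proof -
  assume z: "z \<in> even_lattice"
  have "AE s in distr M (count_space UNIV) (spin z n). s \<in> {-1, 1}"
    unfolding spin_uniform[OF z] by (auto simp: AE_measure_pmf_iff)
  then show ?thesis using z by (subst (asm) AE_distr_iff) auto
qed

text \<open>
  A version of the spins that takes the values \<open>\<plusminus>1\<close> everywhere and is measurable at every site,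
  so that null sets and sites off the lattice need no attention.
\<close>

definition sgn_spin :: "int \<times> int \<Rightarrow> nat \<Rightarrow> 'w \<Rightarrow> int" where
  "sgn_spin z n \<omega> = (if z \<in> even_lattice \<and> spin z n \<omega> \<noteq> 1 then -1 else 1)"

lemma nn_integral_exp_sgn_spin:
  assumes z: "z \<in> even_lattice"
  shows "(\<integral>\<^sup>+\<omega>. ennreal (exp (l * real_of_int (sgn_spin z n \<omega>))) \<partial>M) = ennreal (cosh l)"
proof -
  have "(\<integral>\<^sup>+\<omega>. ennreal (exp (l * real_of_int (sgn_spin z n \<omega>))) \<partial>M) =
    (\<integral>\<^sup>+s. ennreal (exp (l * (if s \<noteq> 1 then -1 else 1))) \<partial>distr M (count_space UNIV) (spin z n))"
    using z by (subst nn_integral_distr) (auto simp: sgn_spin_def intro!: nn_integral_cong)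
  also have "\<dots> = ennreal (cosh l)"
    unfolding spin_uniform[OF z]
    by (subst nn_integral_pmf_of_set) (auto simp: cosh_def ennreal_plus[symmetric]
      divide_ennreal[symmetric] ac_simps simp del: ennreal_plus simp flip: ennreal_numeral)
  finally show ?thesis .
qed

section \<open>The walk at a dynamical time determined by the clocks, and its Chernoff bound\<close>

text \<open>The dynamical time is itself a random variable, so that ring times can be inserted for
  it.\<close>

definition walk :: "('w \<Rightarrow> real) \<Rightarrow> nat \<Rightarrow> 'w \<Rightarrow> int" where
  "walk \<tau> k \<omega> = arrow_pos (\<lambda>z. sgn_spin z (ring_count gap z (\<tau> \<omega>) \<omega>) \<omega>) (0, 0) k"

lemma walk_Suc: "walk \<tau> (Suc k) \<omega> = walk \<tau> k \<omega> +
   sgn_spin (walk \<tau> k \<omega>, int k) (ring_count gap (walk \<tau> k \<omega>, int k) (\<tau> \<omega>) \<omega>) \<omega>"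
  unfolding walk_def by simp

lemma walk_parity: "even (walk \<tau> k \<omega> + int k)"
  unfolding walk_def by (rule arrow_pos_parity) (auto simp: sgn_spin_def)

lemma sgn_spin_measurable_past:
  assumes "snd z < int k"
  shows "sgn_spin z n \<in> past k \<rightarrow>\<^sub>M count_space UNIV"
proof (cases "z \<in> even_lattice")
  case True
  note [measurable] = spin_measurable_past[OF True assms]
  show ?thesis unfolding sgn_spin_def by measurable
qed (simp add: sgn_spin_def[abs_def])

text \<open>Step \<open>k\<close> reads a spin of row \<open>k\<close>, which belongs to
  \<open>past (Suc k)\<close>. Its site and its index are random but take countably many values, so
  measurability can be checked for each fixed value.\<close>

lemma walk_measurable_past:
  assumes \<tau>: "\<tau> \<in> borel_measurable (past 0)"
  shows "walk \<tau> k \<in> past k \<rightarrow>\<^sub>M count_space UNIV"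
proof (induction k)
  case (Suc k)
  have [measurable]: "walk \<tau> k \<in> past (Suc k) \<rightarrow>\<^sub>M count_space UNIV"
    by (rule measurable_past_mono[OF _ Suc]) simp
  have \<tau>': "\<tau> \<in> borel_measurable (past (Suc k))"
    by (rule measurable_past_mono[OF _ \<tau>]) simp
  have "(\<lambda>\<omega>. sgn_spin (x, int k) (ring_count gap (x, int k) (\<tau> \<omega>) \<omega>) \<omega>)
      \<in> past (Suc k) \<rightarrow>\<^sub>M count_space UNIV" for x
  proof (cases "(x, int k) \<in> even_lattice")
    case True
    show ?thesis
      by (rule measurable_compose_countable[OF sgn_spin_measurable_past
          ring_count_measurable_past[OF True \<tau>']]) auto
  qed (simp add: sgn_spin_def)
  then have "(\<lambda>\<omega>. sgn_spin (walk \<tau> k \<omega>, int k) (ring_count gap (walk \<tau> k \<omega>, int k) (\<tau> \<omega>) \<omega>) \<omega>)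
      \<in> past (Suc k) \<rightarrow>\<^sub>M count_space UNIV"
    by (rule measurable_compose_countable) measurable
  then show ?case unfolding walk_Suc[abs_def] by measurable
qed (simp add: walk_def)

lemma walk_measurable: "\<tau> \<in> borel_measurable (past 0) \<Longrightarrow> walk \<tau> k \<in> M \<rightarrow>\<^sub>M count_space UNIV"
  by (rule measurable_past_imp[OF walk_measurable_past])

text \<open>
  On the event that the walk is at \<open>x\<close> at time \<open>k\<close> and that \<open>c\<close> rings have occurred at \<open>(x, k)\<close>, which
  belongs to the past, the next step is the single spin with index \<open>c\<close>, which is independent of
  the past.
\<close>

lemma nn_integral_exp_walk_Suc:
  assumes \<tau>: "\<tau> \<in> borel_measurable (past 0)" and E: "E \<in> sets (past 0)"
  shows "(\<integral>\<^sup>+\<omega>. indicator E \<omega> * ennreal (exp (l * real_of_int (walk \<tau> (Suc k) \<omega>))) \<partial>M) =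
    (\<integral>\<^sup>+\<omega>. indicator E \<omega> * ennreal (exp (l * real_of_int (walk \<tau> k \<omega>))) \<partial>M) * ennreal (cosh l)"
proof -
  let ?I = "{(x, c::nat). even (x + int k)}"
  let ?f = "\<lambda>\<omega>. indicator E \<omega> * ennreal (exp (l * real_of_int (walk \<tau> k \<omega>)))"
  let ?N = "\<lambda>x \<omega>. ring_count gap (x, int k) (\<tau> \<omega>) \<omega>"
  let ?q = "\<lambda>(x, c) \<omega>. ?f \<omega> * indicator {\<omega> \<in> space M. walk \<tau> k \<omega> = x \<and> ?N x \<omega> = c} \<omega>"
  let ?s = "\<lambda>(x, c) \<omega>. ennreal (exp (l * real_of_int (sgn_spin (x, int k) c \<omega>)))"
  have \<tau>': "\<tau> \<in> borel_measurable (past k)" by (rule measurable_past_mono[OF _ \<tau>]) simp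
  have E': "E \<in> sets (past k)" using sets_past_mono[of 0 k] E by auto
  have I: "(x, int k) \<in> even_lattice" if "(x, c) \<in> ?I" for x and c :: nat
    using that by (auto simp: even_lattice_def)
  have q: "?q p \<in> borel_measurable (past k)" if "p \<in> ?I" for p
  proof -
    obtain x c where p: "p = (x, c)" by force
    note [measurable] = E' ring_count_measurable_past[OF I \<tau>'] walk_measurable_past[OF \<tau>, of k]
    have [measurable]: "{\<omega> \<in> space M. walk \<tau> k \<omega> = x \<and> ?N x \<omega> = c} \<in> sets (past k)"
      using that unfolding p space_past[of k, symmetric] by measurable
    show ?thesis unfolding p prod.case by measurable
  qed
  have qM: "?q p \<in> borel_measurable M" if "p \<in> ?I" for p
    by (rule measurable_past_imp[OF q[OF that]])
  have sM: "?s p \<in> borel_measurable M" if "p \<in> ?I" for p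
  proof -
    obtain x c where p: "p = (x, c)" by force
    have [measurable]: "sgn_spin (x, int k) c \<in> M \<rightarrow>\<^sub>M count_space UNIV"
      by (rule measurable_past_imp[OF sgn_spin_measurable_past[of _ "Suc k"]]) simp
    show ?thesis unfolding p by simp
  qed
  \<comment> \<open>For a given outcome exactly one pair contributes: the current position with its
    ring count. The parity of the walk places it in \<open>?I\<close>.\<close>
  have split: "(\<integral>\<^sup>+p. ?q p \<omega> * h p \<partial>count_space ?I) =
      ?f \<omega> * h (walk \<tau> k \<omega>, ?N (walk \<tau> k \<omega>) \<omega>)" if "\<omega> \<in> space M" for \<omega> and h :: "_ \<Rightarrow> ennreal"
  proof -
    let ?p = "(walk \<tau> k \<omega>, ?N (walk \<tau> k \<omega>) \<omega>)"
    have "(\<integral>\<^sup>+p. ?q p \<omega> * h p \<partial>count_space ?I) =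
        (\<integral>\<^sup>+p. (?f \<omega> * h p) * indicator {?p} p \<partial>count_space ?I)"
      using that by (intro nn_integral_cong) (auto simp: indicator_def)
    also have "\<dots> = ?f \<omega> * h ?p"
      using walk_parity[of \<tau> k \<omega>] by (subst nn_integral_indicator_singleton) auto
    finally show ?thesis .
  qed
  have one: "(\<integral>\<^sup>+\<omega>. ?q p \<omega> * ?s p \<omega> \<partial>M) = (\<integral>\<^sup>+\<omega>. ?q p \<omega> \<partial>M) * ennreal (cosh l)" if "p \<in> ?I" for p
  proof -
    obtain x c where p: "p = (x, c)" by force
    \<comment> \<open>On the lattice, \<open>sgn_spin\<close> is a function of the spin alone;
      \<open>g\<close> is this function followed by the exponential.\<close>
    define g :: "real \<Rightarrow> ennreal" where "g s = ennreal (exp (l * (if s \<noteq> 1 then -1 else 1)))" for s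
    have "?s p \<omega> = g (real_of_int (spin (x, int k) c \<omega>))" for \<omega>
      using I[of x c] that unfolding p by (simp add: sgn_spin_def g_def)
    moreover have "g \<in> borel_measurable borel" unfolding g_def by measurable
    ultimately have "(\<integral>\<^sup>+\<omega>. ?q p \<omega> * ?s p \<omega> \<partial>M) = (\<integral>\<^sup>+\<omega>. ?q p \<omega> \<partial>M) * (\<integral>\<^sup>+\<omega>. ?s p \<omega> \<partial>M)"
      using spin_indep_past[OF q[OF that], of "(x, int k)" g c] I[of x c] that unfolding p by simp
    also have "(\<integral>\<^sup>+\<omega>. ?s p \<omega> \<partial>M) = ennreal (cosh l)"
      using nn_integral_exp_sgn_spin[OF I[of x c]] that unfolding p by simp
    finally show ?thesis .
  qed
  \<comment> \<open>Expand over all pairs, exchange sum and integral by Tonelli, factor each term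
    with \<open>one\<close>, and collapse the sum again.\<close>
  have "(\<integral>\<^sup>+\<omega>. indicator E \<omega> * ennreal (exp (l * real_of_int (walk \<tau> (Suc k) \<omega>))) \<partial>M) =
    (\<integral>\<^sup>+\<omega>. (\<integral>\<^sup>+p. ?q p \<omega> * ?s p \<omega> \<partial>count_space ?I) \<partial>M)"
    by (intro nn_integral_cong, subst split)
       (auto simp: walk_Suc distrib_left exp_add ennreal_mult mult.assoc)
  also have "\<dots> = (\<integral>\<^sup>+p. (\<integral>\<^sup>+\<omega>. ?q p \<omega> * ?s p \<omega> \<partial>M) \<partial>count_space ?I)"
    by (rule nn_integral_count_space_nn_integral) (use qM sM in \<open>auto intro!: borel_measurable_times\<close>)
  also have "\<dots> = (\<integral>\<^sup>+p. (\<integral>\<^sup>+\<omega>. ?q p \<omega> * ennreal (cosh l) \<partial>M) \<partial>count_space ?I)"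
  proof (rule nn_integral_cong)
    fix p assume "p \<in> space (count_space ?I)"
    then have p: "p \<in> ?I" by simp
    show "(\<integral>\<^sup>+\<omega>. ?q p \<omega> * ?s p \<omega> \<partial>M) = (\<integral>\<^sup>+\<omega>. ?q p \<omega> * ennreal (cosh l) \<partial>M)"
      by (simp only: one[OF p] nn_integral_multc[OF qM[OF p]])
  qed
  also have "\<dots> = (\<integral>\<^sup>+\<omega>. (\<integral>\<^sup>+p. ?q p \<omega> * ennreal (cosh l) \<partial>count_space ?I) \<partial>M)"
    by (rule nn_integral_count_space_nn_integral[symmetric]) (use qM in \<open>auto intro!: borel_measurable_times\<close>)
  also have "\<dots> = (\<integral>\<^sup>+\<omega>. ?f \<omega> * ennreal (cosh l) \<partial>M)"
    by (intro nn_integral_cong, subst split) auto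
  also have "\<dots> = (\<integral>\<^sup>+\<omega>. ?f \<omega> \<partial>M) * ennreal (cosh l)"
  proof (rule nn_integral_multc)
    note [measurable] = walk_measurable[OF \<tau>, of k] subsetD[OF sets_past_subset E]
    show "?f \<in> borel_measurable M" by measurable
  qed
  finally show ?thesis .
qed

text \<open>Each step contributes a factor \<open>cosh l\<close>, as for a simple random walk. The
  clock event \<open>E\<close> is carried along because it will say that a given ring occurs by
  dynamical time 1; keeping its probability as a factor makes the later sum over all rings
  converge.\<close>

lemma nn_integral_exp_walk:
  assumes "\<tau> \<in> borel_measurable (past 0)" "E \<in> sets (past 0)"
  shows "(\<integral>\<^sup>+\<omega>. indicator E \<omega> * ennreal (exp (l * real_of_int (walk \<tau> k \<omega>))) \<partial>M) =
    emeasure M E * ennreal (cosh l ^ k)"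
proof (induction k)
  case 0
  then show ?case using assms sets_past_subset[of 0] by (auto simp: walk_def)
next
  case (Suc k)
  then show ?case
    by (simp add: nn_integral_exp_walk_Suc[OF assms] ennreal_mult' mult_ac)
qed

text \<open>Markov's inequality for the exponential moment, with \<open>cosh l\<close> bounded by
  exp (l^2). The parameter \<open>l\<close> stays free and is optimised later.\<close>

lemma walk_tail:
  assumes \<tau>: "\<tau> \<in> borel_measurable (past 0)" and E: "E \<in> sets (past 0)" and l: "0 \<le> l" "l \<le> 1"
  shows "emeasure M (E \<inter> {\<omega> \<in> space M. a \<le> real_of_int (walk \<tau> n \<omega>)}) \<le>
    emeasure M E * ennreal (exp (real n * l\<^sup>2 - l * a))"
proof -
  let ?A = "E \<inter> {\<omega> \<in> space M. a \<le> real_of_int (walk \<tau> n \<omega>)}"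
  note [measurable] = walk_measurable[OF \<tau>, of n] subsetD[OF sets_past_subset E]
  have "ennreal (exp (l * a)) * emeasure M ?A = (\<integral>\<^sup>+\<omega>. ennreal (exp (l * a)) * indicator ?A \<omega> \<partial>M)"
    by (rule nn_integral_cmult_indicator[symmetric]) measurable
  also have "\<dots> \<le> (\<integral>\<^sup>+\<omega>. indicator E \<omega> * ennreal (exp (l * real_of_int (walk \<tau> n \<omega>))) \<partial>M)"
    using l by (intro nn_integral_mono)
      (auto split: split_indicator intro!: ennreal_leI mult_left_mono)
  also have "\<dots> = emeasure M E * ennreal (cosh l ^ n)"
    by (rule nn_integral_exp_walk[OF \<tau> E])
  also have "cosh l ^ n \<le> exp (l\<^sup>2) ^ n"
    using cosh_le_exp_square[OF l] by (intro power_mono) (auto simp: cosh_real_nonneg)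
  then have "emeasure M E * ennreal (cosh l ^ n) \<le> emeasure M E * ennreal (exp (real n * l\<^sup>2))"
    by (intro mult_left_mono ennreal_leI) (auto simp: exp_of_nat_mult)
  \<comment> \<open>Multiplying by the reciprocal exponential takes the place of a division in
    \<open>ennreal\<close>.\<close>
  finally have "ennreal (exp (- (l * a))) * (ennreal (exp (l * a)) * emeasure M ?A)
      \<le> ennreal (exp (- (l * a))) * (emeasure M E * ennreal (exp (real n * l\<^sup>2)))"
    by (intro mult_left_mono) auto
  moreover have "ennreal (exp (- (l * a))) * ennreal (exp (l * a)) = 1"
    by (simp add: ennreal_mult''[symmetric] exp_add[symmetric])
  moreover have "ennreal (exp (- (l * a))) * ennreal (exp (real n * l\<^sup>2)) =
      ennreal (exp (real n * l\<^sup>2 - l * a))"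
    by (simp add: ennreal_mult''[symmetric] exp_add[symmetric])
  ultimately show ?thesis
    by (simp only: mult.assoc[symmetric] mult_1_left)
      (simp only: mult.assoc mult.left_commute[of _ "emeasure M E"])
qed

section \<open>Rings up to dynamical time 1\<close>

text \<open>Tilting the density of parameter 1 by exp (-x) gives half the density of parameter
  2.\<close>

lemma nn_integral_exp_gap:
  assumes "z \<in> even_lattice"
  shows "(\<integral>\<^sup>+\<omega>. ennreal (exp (- gap z n \<omega>)) \<partial>M) = ennreal (1 / 2)"
proof -
  have "(\<integral>\<^sup>+\<omega>. ennreal (exp (- gap z n \<omega>)) \<partial>M) =
      (\<integral>\<^sup>+x. ennreal (exponential_density 1 x) * ennreal (exp (- x)) \<partial>lborel)"
    by (rule distributed_nn_integral[OF gap_exponential[OF assms], symmetric]) measurable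
  also have "\<dots> = (\<integral>\<^sup>+x. ennreal (1 / 2) * ennreal (exponential_density 2 x) \<partial>lborel)"
  proof (rule nn_integral_cong)
    fix x :: real
    have "exponential_density 1 x * exp (- x) = 1 / 2 * exponential_density 2 x"
      by (simp add: exponential_density_def exp_add[symmetric])
    then show "ennreal (exponential_density 1 x) * ennreal (exp (- x)) =
        ennreal (1 / 2) * ennreal (exponential_density 2 x)"
      by (metis ennreal_mult' ennreal_mult'' exp_ge_zero divide_nonneg_nonneg zero_le_one zero_le_numeral)
  qed
  also have "\<dots> = ennreal (1 / 2) * (\<integral>\<^sup>+x. ennreal (exponential_density 2 x) \<partial>lborel)"
    by (rule nn_integral_cmult) measurable
  also have "(\<integral>\<^sup>+x. ennreal (exponential_density 2 x) \<partial>lborel) = 1"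
    using prob_space.emeasure_space_1[OF prob_space_exponential_density[of 2]]
    by (simp add: emeasure_density)
  finally show ?thesis by simp
qed

text \<open>Markov's inequality for exp (1 - \<open>ring_time\<close>). Ring \<open>j\<close> is the
  sum of \<open>j + 1\<close> independent gaps, each contributing a factor 1/2, and the constant 3
  bounds exp 1.\<close>

lemma ring_time_tail:
  assumes z[measurable]: "z \<in> even_lattice"
  shows "emeasure M {\<omega> \<in> space M. ring_time gap z j \<omega> \<le> 1} \<le> ennreal (3 * (1 / 2) ^ Suc j)"
proof -
  let ?A = "{\<omega> \<in> space M. ring_time gap z j \<omega> \<le> 1}"
  have "emeasure M ?A = (\<integral>\<^sup>+\<omega>. indicator ?A \<omega> \<partial>M)" by simp
  also have "\<dots> \<le> (\<integral>\<^sup>+\<omega>. ennreal (exp 1) * (\<Prod>k\<in>{..j}. ennreal (exp (- gap z k \<omega>))) \<partial>M)"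
  proof (intro nn_integral_mono)
    fix \<omega>
    have "ennreal (exp 1) * (\<Prod>k\<in>{..j}. ennreal (exp (- gap z k \<omega>))) = ennreal (exp (1 - ring_time gap z j \<omega>))"
      by (simp add: prod_ennreal ennreal_mult[symmetric] exp_sum[symmetric] sum_negf
          ring_time_def exp_add[symmetric])
    then show "indicator ?A \<omega> \<le> ennreal (exp 1) * (\<Prod>k\<in>{..j}. ennreal (exp (- gap z k \<omega>)))"
      by (auto split: split_indicator)
  qed
  also have "\<dots> = ennreal (exp 1) * (\<integral>\<^sup>+\<omega>. (\<Prod>k\<in>{..j}. ennreal (exp (- gap z k \<omega>))) \<partial>M)"
    by (rule nn_integral_cmult) measurable
  also have "(\<integral>\<^sup>+\<omega>. (\<Prod>k\<in>{..j}. ennreal (exp (- gap z k \<omega>))) \<partial>M) =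
      (\<integral>\<^sup>+\<omega>. (\<Prod>i\<in>(\<lambda>k. Inr (z, k)) ` {..j}. ennreal (exp (- coord i \<omega>))) \<partial>M)"
    by (subst prod.reindex) (auto simp: inj_on_def)
  also have "\<dots> = (\<Prod>i\<in>(\<lambda>k. Inr (z, k)) ` {..j}. \<integral>\<^sup>+\<omega>. ennreal (exp (- coord i \<omega>)) \<partial>M)"
    by (intro indep_vars_nn_integral indep_vars_compose2[where Y = "\<lambda>_ x. ennreal (exp (- x))",
          OF indep_vars_subset[OF all_independent]]) (use z in auto)
  also have "\<dots> = (\<Prod>k\<in>{..j}. \<integral>\<^sup>+\<omega>. ennreal (exp (- gap z k \<omega>)) \<partial>M)"
    by (subst prod.reindex) (auto simp: inj_on_def)
  also have "\<dots> = ennreal ((1 / 2) ^ Suc j)"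
    by (simp only: nn_integral_exp_gap[OF z] prod_constant card_atMost) (rule ennreal_power, simp)
  also have "ennreal (exp 1) * \<dots> \<le> ennreal (3 * (1 / 2) ^ Suc j)"
    using exp_le by (simp add: ennreal_mult[symmetric] ennreal_leI del: power_Suc)
  finally show ?thesis .
qed

text \<open>The sum is the expected number of rings at one site up to dynamical time 1. A bound
  uniform in \<open>z\<close> makes the total over the light cone proportional to its size.\<close>

lemma suminf_ring_time_tail:
  assumes "z \<in> even_lattice"
  shows "(\<Sum>j. emeasure M {\<omega> \<in> space M. ring_time gap z j \<omega> \<le> 1}) \<le> 3"
proof -
  have "(\<lambda>j. 3 * (1 / 2) ^ Suc j :: real) sums (3 * 1)"
    by (intro sums_mult power_half_series)
  then have "(\<Sum>j. ennreal (3 * (1 / 2) ^ Suc j)) = ennreal 3"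
    by (intro suminf_ennreal_eq) auto
  moreover have "(\<Sum>j. emeasure M {\<omega> \<in> space M. ring_time gap z j \<omega> \<le> 1}) \<le>
      (\<Sum>j. ennreal (3 * (1 / 2) ^ Suc j))"
    by (intro suminf_le ring_time_tail[OF assms] summableI)
  ultimately show ?thesis by (simp only: ennreal_numeral)
qed

text \<open>The tail bounds are summable, so Borel-Cantelli applies. Finiteness later allows the
  last ring before a given dynamical time to be chosen as a maximum.\<close>

lemma AE_finite_rings:
  assumes z[measurable]: "z \<in> even_lattice"
  shows "AE \<omega> in M. finite {j. ring_time gap z j \<omega> \<le> 1}"
proof -
  let ?A = "\<lambda>j. {\<omega> \<in> space M. ring_time gap z j \<omega> \<le> 1}"
  have "norm (measure M (?A j)) \<le> 3 * (1 / 2) ^ Suc j" for j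
    using ring_time_tail[OF z, of j] by (simp add: emeasure_eq_measure)
  then have "summable (\<lambda>j. measure M (?A j))"
    by (rule summable_comparison_test'[OF summable_mult[OF sums_summable[OF power_half_series]]])
  then have "AE \<omega> in M. eventually (\<lambda>j. \<omega> \<in> space M - ?A j) sequentially"
    by (intro borel_cantelli_AE1) (auto simp: emeasure_eq_measure)
  then show ?thesis
  proof eventually_elim
    case (elim \<omega>)
    then have "eventually (\<lambda>j. \<not> ring_time gap z j \<omega> \<le> 1) cofinite"
      unfolding cofinite_eq_sequentially by (rule eventually_mono) auto
    then show ?case by (simp add: eventually_cofinite)
  qed
qed

section \<open>The union bound over the rings in the light cone\<close>

definition cone :: "nat \<Rightarrow> (int \<times> int) set" where
  "cone n = {(x, t). \<bar>x\<bar> \<le> t \<and> t < int n \<and> even (x + t)}"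

lemma cone_subset: "cone n \<subseteq> {- int n..int n} \<times> {0..<int n}"
  unfolding cone_def by auto

lemma finite_cone [simp]: "finite (cone n)"
  by (rule finite_subset[OF cone_subset]) simp

lemma card_cone: "card (cone n) \<le> (2 * n + 1) * n"
  using card_mono[OF _ cone_subset, of n] by (simp add: card_cartesian_product nat_add_distrib nat_mult_distrib)

lemma cone_even: "z \<in> cone n \<Longrightarrow> z \<in> even_lattice"
  unfolding cone_def even_lattice_def by auto

text \<open>Within the cone, the arrows visible during \<open>[0, 1]\<close> are those at time \<open>0\<close> and at the ring times.\<close>

definition high :: "nat \<Rightarrow> real \<Rightarrow> 'w set" where
  "high n a = {\<omega> \<in> space M. a \<le> real_of_int (walk (\<lambda>_. 0) n \<omega>)} \<union>
     (\<Union>z\<in>cone n. \<Union>j. {\<omega> \<in> space M. ring_time gap z j \<omega> \<le> 1} \<inter>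
        {\<omega> \<in> space M. a \<le> real_of_int (walk (ring_time gap z j) n \<omega>)})"

text \<open>Dynamical time 0 contributes one Chernoff bound. Each site of the cone contributes at
  most three, by the expected number of its rings, and there are at most (2n + 1)n sites.\<close>

lemma
  assumes l: "0 \<le> l" "l \<le> 1"
  shows high_measurable: "high n a \<in> sets M"
    and emeasure_high_le: "emeasure M (high n a) \<le>
      ennreal ((1 + 3 * real ((2 * n + 1) * n)) * exp (real n * l\<^sup>2 - l * a))"
proof -
  define p where "p = ennreal (exp (real n * l\<^sup>2 - l * a))"
  define T where "T z j = {\<omega> \<in> space M. ring_time gap z j \<omega> \<le> 1}" for z j
  define W where "W \<tau> = {\<omega> \<in> space M. a \<le> real_of_int (walk \<tau> n \<omega>)}" for \<tau>
  define H where "H z = (\<Union>j. T z j \<inter> W (ring_time gap z j))" for z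
  have high_eq: "high n a = W (\<lambda>_. 0) \<union> (\<Union>z\<in>cone n. H z)"
    unfolding high_def H_def T_def W_def ..
  have W: "W \<tau> \<in> sets M" if "\<tau> \<in> borel_measurable (past 0)" for \<tau>
    using walk_measurable[OF that, of n] unfolding W_def by measurable
  have T: "T z j \<in> sets (past 0)" if "z \<in> cone n" for z j
  proof -
    note [measurable] = cone_even[OF that]
    show ?thesis unfolding T_def space_past[of 0, symmetric] by measurable
  qed
  have TW: "T z j \<inter> W (ring_time gap z j) \<in> sets M" if "z \<in> cone n" for z j
    by (rule sets.Int[OF subsetD[OF sets_past_subset T[OF that]]
          W[OF ring_time_measurable_past[OF cone_even[OF that]]]])
  have H: "H z \<in> sets M" if "z \<in> cone n" for z
    unfolding H_def using TW[OF that] by (intro sets.countable_UN) auto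
  have HU: "(\<Union>z\<in>cone n. H z) \<in> sets M"
    by (rule sets.finite_UN[OF finite_cone H])
  have W0: "W (\<lambda>_. 0) \<in> sets M" by (rule W) simp
  show "high n a \<in> sets M"
    unfolding high_eq by (rule sets.Un[OF W0 HU])
  have "emeasure M (space M \<inter> W (\<lambda>_. 0)) \<le> emeasure M (space M) * p"
    unfolding W_def p_def using sets.top[of "past 0"] by (intro walk_tail l) simp_all
  then have le_W0: "emeasure M (W (\<lambda>_. 0)) \<le> p"
    using sets.sets_into_space[OF W0] by (simp add: emeasure_space_1 Int_absorb1)
  have le_H: "emeasure M (H z) \<le> 3 * p" if z: "z \<in> cone n" for z
  proof -
    have "emeasure M (H z) \<le> (\<Sum>j. emeasure M (T z j \<inter> W (ring_time gap z j)))"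
      unfolding H_def using TW[OF z] by (intro emeasure_subadditive_countably) auto
    \<comment> \<open>Whether ring \<open>j\<close> occurs by time 1 is decided by the clocks, so
      \<open>T z j\<close> can serve as the event \<open>E\<close> of
      \<open>walk_tail\<close>.\<close>
    also have "\<dots> \<le> (\<Sum>j. emeasure M (T z j) * p)"
      unfolding W_def p_def
      by (intro suminf_le walk_tail summableI l T[OF z] ring_time_measurable_past cone_even[OF z])
    also have "\<dots> = (\<Sum>j. emeasure M (T z j)) * p" by simp
    also have "\<dots> \<le> 3 * p"
      using suminf_ring_time_tail[OF cone_even[OF z]] unfolding T_def by (rule mult_right_mono) simp
    finally show ?thesis .
  qed
  have "emeasure M (\<Union>z\<in>cone n. H z) \<le> (\<Sum>z\<in>cone n. emeasure M (H z))"
    using H by (intro emeasure_subadditive_finite) auto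
  also have "\<dots> \<le> (\<Sum>z\<in>cone n. 3 * p)"
    by (intro sum_mono le_H)
  also have "\<dots> = of_nat (card (cone n)) * (3 * p)" by simp
  also have "\<dots> \<le> of_nat ((2 * n + 1) * n) * (3 * p)"
    by (intro mult_right_mono of_nat_mono card_cone) simp
  finally have le_HU: "emeasure M (\<Union>z\<in>cone n. H z) \<le> of_nat ((2 * n + 1) * n) * (3 * p)" .
  have "emeasure M (high n a) \<le> emeasure M (W (\<lambda>_. 0)) + emeasure M (\<Union>z\<in>cone n. H z)"
    unfolding high_eq by (rule emeasure_subadditive[OF W0 HU])
  also have "\<dots> \<le> p + of_nat ((2 * n + 1) * n) * (3 * p)"
    by (rule add_mono[OF le_W0 le_HU])
  also have "\<dots> = of_nat (1 + 3 * ((2 * n + 1) * n)) * p"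
    by (simp only: of_nat_add of_nat_mult of_nat_numeral of_nat_1 distrib_left mult_1_left mult_1_right mult_ac)
  also have "of_nat (1 + 3 * ((2 * n + 1) * n)) = ennreal (1 + 3 * real ((2 * n + 1) * n))"
    by (subst ennreal_of_nat_eq_real_of_nat) (simp only: of_nat_add of_nat_mult of_nat_numeral of_nat_1)
  also have "\<dots> * p = ennreal ((1 + 3 * real ((2 * n + 1) * n)) * exp (real n * l\<^sup>2 - l * a))"
    unfolding p_def by (rule ennreal_mult''[symmetric]) simp
  finally show "emeasure M (high n a) \<le> \<dots>" .
qed

section \<open>Reduction of an arbitrary dynamical time to time 0 or a ring time\<close>

definition regular :: "'w \<Rightarrow> bool" where
  "regular \<omega> \<longleftrightarrow> (\<forall>z\<in>even_lattice.
     finite {j. ring_time gap z j \<omega> \<le> 1} \<and> (\<forall>n. spin z n \<omega> \<in> {-1, 1}))"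

text \<open>The lattice is countable, so one null set serves all sites, and the pathwise arguments
  that follow then hold for all dynamical times at once.\<close>

lemma AE_regular: "AE \<omega> in M. regular \<omega>"
proof -
  have "AE \<omega> in M. \<forall>z\<in>even_lattice.
     finite {j. ring_time gap z j \<omega> \<le> 1} \<and> (\<forall>n. spin z n \<omega> \<in> {-1, 1})"
    using AE_finite_rings AE_spin
    by (subst AE_ball_countable) (auto simp: AE_all_countable AE_conj_iff)
  then show ?thesis unfolding regular_def .
qed

text \<open>Equal ring counts on the cone select the same spins there, so the two paths agree up to
  time \<open>n\<close>. The counts are compared only at the given outcome, which lets a random time
  \<open>\<sigma>\<close> be matched with a fixed number \<open>\<tau>\<close>.\<close>

lemma arrow_pos_\<xi>_eq_walk:
  assumes reg: "regular \<omega>" and "k \<le> n"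
    and count: "\<And>z. z \<in> cone n \<Longrightarrow> ring_count gap z (\<sigma> \<omega>) \<omega> = ring_count gap z \<tau> \<omega>"
  shows "arrow_pos (\<lambda>z. \<xi> spin gap z \<tau> \<omega>) (0, 0) k = walk \<sigma> k \<omega>"
proof -
  have *: "\<xi> spin gap (x, t) \<tau> \<omega> = sgn_spin (x, t) (ring_count gap (x, t) (\<sigma> \<omega>) \<omega>) \<omega>"
    if "\<bar>x\<bar> \<le> t" "t < int n" "even (x + t)" for x t
  proof -
    have z: "(x, t) \<in> cone n" using that by (simp add: cone_def)
    show ?thesis
      using reg cone_even[OF z] unfolding count[OF z] regular_def \<xi>_def sgn_spin_def by auto
  qed
  show ?thesis
    unfolding walk_def
    by (rule arrow_pos_cong[where n = n, THEN conjunct1]) (use * \<open>k \<le> n\<close> in \<open>auto simp: sgn_spin_def\<close>)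
qed

text \<open>Let \<open>s\<close> be the maximum of 0 and the ring times in the cone up to
  \<open>\<tau>\<close>. No clock of the cone rings after \<open>s\<close> and up to
  \<open>\<tau>\<close>, so the path at \<open>\<tau>\<close> is already the path at
  \<open>s\<close>, which is among the times covered by \<open>high\<close>.\<close>

lemma in_high:
  assumes reg: "regular \<omega>" and \<omega>: "\<omega> \<in> space M" and \<tau>: "\<tau> \<in> {0..1}"
    and a: "a \<le> real_of_int (arrow_pos (\<lambda>z. \<xi> spin gap z \<tau> \<omega>) (0, 0) n)"
  shows "\<omega> \<in> high n a"
proof -
  define R where "R = (\<Union>z\<in>cone n. (\<lambda>j. ring_time gap z j \<omega>) ` {j. ring_time gap z j \<omega> \<le> \<tau>})"
  define s where "s = Max (insert 0 R)"
  have "finite {j. ring_time gap z j \<omega> \<le> \<tau>}" if "z \<in> cone n" for z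
    using reg cone_even[OF that] \<tau> unfolding regular_def
    by (auto intro: rev_finite_subset[of "{j. ring_time gap z j \<omega> \<le> 1}"])
  then have fin: "finite R" unfolding R_def by (intro finite_UN_I finite_imageI) auto
  have "s \<le> \<tau>" using fin \<tau> unfolding s_def by (subst Max_le_iff) (auto simp: R_def)
  have s: "s \<in> insert 0 R" unfolding s_def using fin by (intro Max_in) auto
  have count: "ring_count gap z s \<omega> = ring_count gap z \<tau> \<omega>" if "z \<in> cone n" for z
  proof -
    have "ring_time gap z j \<omega> \<le> s" if "ring_time gap z j \<omega> \<le> \<tau>" for j
      unfolding s_def using fin that \<open>z \<in> cone n\<close> by (intro Max_ge) (auto simp: R_def)
    with \<open>s \<le> \<tau>\<close> have "{j. ring_time gap z j \<omega> \<le> s} = {j. ring_time gap z j \<omega> \<le> \<tau>}" by force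
    then show ?thesis unfolding ring_count_def by simp
  qed
  \<comment> \<open>The random time need only take the value \<open>s\<close> at this outcome; the
    constant 0 and the ring time attaining the maximum both qualify.\<close>
  have W: "a \<le> real_of_int (walk \<sigma> n \<omega>)" if "\<sigma> \<omega> = s" for \<sigma>
    using a arrow_pos_\<xi>_eq_walk[OF reg order_refl, of n \<sigma> \<tau>] count that by simp
  from s consider "s = 0" | z j where "z \<in> cone n" "s = ring_time gap z j \<omega>"
    unfolding R_def by auto
  then show ?thesis
  proof cases
    case 1
    then show ?thesis using W[of "\<lambda>_. 0"] \<omega> by (auto simp: high_def)
  next
    case 2
    with W[of "ring_time gap z j"] \<omega> \<open>s \<le> \<tau>\<close> \<tau> show ?thesis by (auto simp: high_def)
  qed
qed

section \<open>Borel-Cantelli over the times \<open>n\<close>, and the limsup of the interpolated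
  path\<close>

lemma AE_eventually_not_high:
  "AE \<omega> in M. eventually (\<lambda>n. \<omega> \<notin> high n (4 * sqrt (real n * ln (real n)))) sequentially"
proof -
  let ?A = "\<lambda>n. high n (4 * sqrt (real n * ln (real n)))"
  have A: "?A n \<in> sets M" for n by (rule high_measurable[of 0]) auto
  \<comment> \<open>This quantity is the square of the Chernoff parameter chosen below, which must
    not exceed 1.\<close>
  have "eventually (\<lambda>n::nat. 4 * ln (real n) / real n \<le> 1) sequentially" by real_asymp
  then have "eventually (\<lambda>n. norm (measure M (?A n)) \<le> 10 * (1 / real n ^ 2)) sequentially"
    using eventually_gt_at_top[of 1]
  proof eventually_elim
    case (elim n)
    \<comment> \<open>With a = 4 sqrt (n ln n), the exponent n l^2 - l a is minimal at l = a / (2n),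
      with value -4 ln n. The resulting n^(-4) beats the quadratic number of expected rings and
      leaves a summable n^(-2).\<close>
    let ?l = "2 * sqrt (ln (real n) / real n)"
    have l: "0 \<le> ?l" "?l \<le> 1"
      using elim real_sqrt_le_mono[of "4 * ln (real n) / real n" 1] by (auto simp: real_sqrt_mult real_sqrt_divide)
    have "real n * ?l\<^sup>2 = 4 * ln (real n)"
      using elim by (simp add: power_mult_distrib)
    moreover have "?l * (4 * sqrt (real n * ln (real n))) = 8 * ln (real n)"
      using elim by (simp add: real_sqrt_divide real_sqrt_mult)
    ultimately have "exp (real n * ?l\<^sup>2 - ?l * (4 * sqrt (real n * ln (real n)))) = exp (- (real 4 * ln (real n)))"
      by simp
    also have "\<dots> = 1 / real n ^ 4"
      using elim by (simp only: exp_minus exp_of_nat_mult) (simp add: divide_inverse)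
    finally have "measure M (?A n) \<le> (1 + 3 * real ((2 * n + 1) * n)) * (1 / real n ^ 4)"
      using emeasure_high_le[OF l, of n "4 * sqrt (real n * ln (real n))"]
      by (simp add: emeasure_eq_measure del: of_nat_mult of_nat_add)
    also have "\<dots> \<le> (10 * real n ^ 2) * (1 / real n ^ 4)"
    proof (rule mult_right_mono)
      have "1 + 3 * ((2 * n + 1) * n) \<le> 10 * n ^ 2"
      proof -
        have "n \<le> n * n" "1 \<le> n * n" using elim by auto
        moreover have "1 + 3 * ((2 * n + 1) * n) = 1 + 6 * (n * n) + 3 * n" by (simp add: algebra_simps)
        ultimately show ?thesis unfolding power2_eq_square by linarith
      qed
      then have "real (1 + 3 * ((2 * n + 1) * n)) \<le> real (10 * n ^ 2)" by (rule of_nat_mono)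
      then show "1 + 3 * real ((2 * n + 1) * n) \<le> 10 * real n ^ 2" by simp
    qed simp
    also have "\<dots> = 10 * (1 / real n ^ 2)"
      using elim by (simp add: field_simps power_numeral_reduce)
    finally show ?case by simp
  qed
  moreover have "summable (\<lambda>n. 10 * (1 / real n ^ 2))"
    using inverse_power_summable[of 2, where 'a = real] by (intro summable_mult) (simp add: divide_inverse)
  ultimately have "summable (\<lambda>n. measure M (?A n))"
    by (rule summable_comparison_test_ev)
  then have "AE \<omega> in M. eventually (\<lambda>n. \<omega> \<in> space M - ?A n) sequentially"
    using A by (intro borel_cantelli_AE1) (auto simp: emeasure_eq_measure)
  then show ?thesis
    by eventually_elim (auto elim: eventually_mono)
qed

lemma Limsup_dyn_path_le:
  assumes reg: "regular \<omega>" and \<omega>: "\<omega> \<in> space M" and \<tau>: "\<tau> \<in> {0..1}"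
    and ev: "eventually (\<lambda>n. \<omega> \<notin> high n (4 * sqrt (real n * ln (real n)))) sequentially"
  shows "Limsup at_top (\<lambda>t::real. ereal (dyn_path spin gap (0, 0) \<tau> \<omega> t / sqrt (t * ln t))) \<le> ereal (9 / 2)"
proof (rule Limsup_bounded)
  let ?S = "arrow_pos (\<lambda>z. \<xi> spin gap z \<tau> \<omega>) (0, 0)"
  \<comment> \<open>Taking the constant time \<open>\<tau>\<close> makes the comparison of ring
    counts trivial; the path thus inherits the unit steps of the walk.\<close>
  have S: "?S k = walk (\<lambda>_. \<tau>) k \<omega>" for k
    by (rule arrow_pos_\<xi>_eq_walk[OF reg order_refl]) simp
  have step: "real_of_int (?S (Suc k)) \<le> real_of_int (?S k) + 1" for k
    unfolding S walk_Suc by (simp add: sgn_spin_def)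
  have "eventually (\<lambda>n. real_of_int (?S n) < 4 * sqrt (real n * ln (real n))) sequentially"
    using ev
  proof (rule eventually_mono)
    fix n assume "\<omega> \<notin> high n (4 * sqrt (real n * ln (real n)))"
    then have "\<not> 4 * sqrt (real n * ln (real n)) \<le> real_of_int (?S n)"
      using in_high[OF reg \<omega> \<tau>] by blast
    then show "real_of_int (?S n) < 4 * sqrt (real n * ln (real n))" by simp
  qed
  moreover have "filterlim (\<lambda>t::real. nat \<lfloor>t\<rfloor>) sequentially at_top"
    by (rule filterlim_compose[OF filterlim_nat_sequentially filterlim_floor_sequentially])
  ultimately have 1: "eventually (\<lambda>t. real_of_int (?S (nat \<lfloor>t\<rfloor>)) <
      4 * sqrt (real (nat \<lfloor>t\<rfloor>) * ln (real (nat \<lfloor>t\<rfloor>)))) (at_top :: real filter)"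
    by (rule eventually_compose_filterlim)
  \<comment> \<open>Interpolation raises the bound by at most 1, which is at most half of sqrt (t ln
    t) once that root reaches 2. This turns the constant 4 into 9/2.\<close>
  have 2: "eventually (\<lambda>t::real. 2 \<le> sqrt (t * ln t)) at_top" by real_asymp
  show "eventually (\<lambda>t. ereal (dyn_path spin gap (0, 0) \<tau> \<omega> t / sqrt (t * ln t)) \<le> ereal (9 / 2)) at_top"
    using 1 2 eventually_ge_at_top[of 1]
  proof eventually_elim
    case (elim t)
    define k where "k = nat \<lfloor>t\<rfloor>"
    have k: "1 \<le> real k" "real k \<le> t" using elim unfolding k_def by auto
    have "dyn_path spin gap (0, 0) \<tau> \<omega> t = (1 - frac t) * ?S k + frac t * ?S (Suc k)"
      by (simp add: dyn_path_def arrow_path_def k_def Let_def)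
    also have "\<dots> \<le> (1 - frac t) * ?S k + frac t * (?S k + 1)"
      using step[of k] by (intro add_left_mono mult_left_mono) auto
    also have "\<dots> \<le> ?S k + 1"
      using frac_lt_1[of t] by (simp add: algebra_simps)
    also have "\<dots> \<le> 4 * sqrt (real k * ln (real k)) + 1"
      using elim unfolding k_def by simp
    also have "sqrt (real k * ln (real k)) \<le> sqrt (t * ln t)"
      using k by (intro real_sqrt_le_mono mult_mono) auto
    finally have "dyn_path spin gap (0, 0) \<tau> \<omega> t \<le> 9 / 2 * sqrt (t * ln t)"
      using elim by simp
    moreover have "0 < sqrt (t * ln t)" using elim by linarith
    ultimately show ?case by (simp only: ereal_less_eq pos_divide_le_eq)
  qed
qed

end

theorem theorem4:
  "\<exists>C1::real. \<forall>C\<ge>C1. \<forall>(M :: 'w measure) spin gap. dynamical_discrete_web M spin gap \<longrightarrow>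
     {\<omega> \<in> space M. \<exists>\<tau>\<in>{0..1::real}.
        Limsup at_top (\<lambda>t::real. ereal (dyn_path spin gap (0, 0) \<tau> \<omega> t / sqrt (t * ln t))) \<ge> ereal C}
       \<in> null_sets (completion M)"
proof (intro exI[of _ 5] allI impI)
  fix C :: real and M :: "'w measure" and spin gap
  \<comment> \<open>The pathwise limsup bound is 9/2, so the threshold 5 yields a strict
    contradiction.\<close>
  assume C: "5 \<le> C" and "dynamical_discrete_web M spin gap"
  then interpret dynamical_discrete_web M spin gap by simp
  let ?L = "\<lambda>\<tau> \<omega>. Limsup at_top (\<lambda>t::real. ereal (dyn_path spin gap (0, 0) \<tau> \<omega> t / sqrt (t * ln t)))"
  have "AE \<omega> in M. \<not> (\<exists>\<tau>\<in>{0..1}. ereal C \<le> ?L \<tau> \<omega>)"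
    using AE_regular AE_eventually_not_high AE_space
  proof eventually_elim
    case (elim \<omega>)
    show ?case
    proof
      assume "\<exists>\<tau>\<in>{0..1}. ereal C \<le> ?L \<tau> \<omega>"
      then obtain \<tau> where "\<tau> \<in> {0..1}" "ereal C \<le> ?L \<tau> \<omega>" by blast
      with Limsup_dyn_path_le[of \<omega> \<tau>] elim have "ereal C \<le> ereal (9 / 2)"
        by (blast intro: order_trans)
      with C show False by simp
    qed
  qed
  \<comment> \<open>The event is an uncountable union over \<open>\<tau>\<close> whose measurability
    has not been established; it is covered by a null set of \<open>M\<close> and is therefore null
    in the completion.\<close>
  then obtain N where "N \<in> null_sets M" "{\<omega> \<in> space M. \<exists>\<tau>\<in>{0..1}. ereal C \<le> ?L \<tau> \<omega>} \<subseteq> N"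
    by (auto elim!: AE_E simp: null_sets_def)
  then show "{\<omega> \<in> space M. \<exists>\<tau>\<in>{0..1}. ereal C \<le> ?L \<tau> \<omega>} \<in> null_sets (completion M)"
    unfolding null_sets_completion_iff2 by blast
qed

end
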